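(* The following hold for well-typed effect values: (1) $\mathrm{Op}_s(V)=\langle0,V\rangle$ (the Dirac distribution) for every value $V$. (2) $\mathrm{Op}_s(E_1\,\mathtt{or}\,E_2)=\mathrm{Op}_s(E_1)\,\max_{\mathbf E}\,\mathrm{Op}_s(E_2)$. (3) $\mathrm{Op}_s(c\cdot E)=[\![c]\!]\cdot\mathrm{Op}_s(E)$. (4) $\mathrm{Op}_s(E_1+_pE_2)=p\,\mathrm{Op}_s(E_1)+(1-p)\,\mathrm{Op}_s(E_2)$ for all $p\in[0,1]$.
   Context: **Language.** Fix base types $b$, including $\mathtt{Bool}$ and $\mathtt{Rew}$; constants $c:b$ (including $\mathtt{tt},\mathtt{ff}:\mathtt{Bool}$ and $0:\mathtt{Rew}$); and function symbols $f:b_1\ldots b_m\to b$. Types: $\sigma::=b\mid\mathtt{Unit}\mid\sigma\times\sigma\mid\sigma\to\sigma$. Terms: $M::=x\mid c\mid f(M_1,\dots,M_m)\mid\mathtt{if}\,L\,\mathtt{then}\,M\,\mathtt{else}\,N\mid M\,\mathtt{or}\,N\mid N\cdot M\mid M+_pN\ (p\in[0,1])\mid *\mid\langle M,N\rangle\mid\mathtt{fst}(M)\mid\mathtt{snd}(M)\mid\lambda x{:}\sigma.M\mid MN$ with standard simple typing; $M\,\mathtt{or}\,N$ and $M+_pN$ have type $\sigma$ when $M,N:\sigma$, and $N\cdot M:\sigma$ when $N:\mathtt{Rew}$, $M:\sigma$. Values (closed): $V::=c\mid *\mid\langle V,W\rangle\mid\lambda x{:}\sigma.M$; $\mathrm{Val}_\sigma$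 is the set of values of type $\sigma$. Effect values: $E::=V\mid E_1\,\mathtt{or}\,E_2\mid c\cdot E\mid E_1+_pE_2$ ($c:\mathtt{Rew}$). **Rewards.** A barycentric algebra is a set with binary operations $+_p$ ($p\in[0,1]$) such that $x+_1y=x$, $x+_px=x$, $x+_py=y+_{1-p}x$ and $(x+_py)+_qz=x+_{pq}(y+_{(1-p)q/(1-pq)}z)$ for $p,q<1$; finite convex combinations $\sum_ip_ix_i$ are then defined as usual. $R$ is a set with a barycentric algebra structure $+_p$, a commutative monoid structure $(+,0)$ with $r+(s+_ps')=(r+s)+_p(r+s')$, and a total order $\le$ such that for all $r,s,t$: $r\le s\iff r+t\le s+t$, and $r\le s\iff r+_pt\le s+_pt$ for $p\in(0,1)$. Each constant $c:\mathtt{Rew}$ has a denotation $[\![c]\!]\in R$, with $[\![0]\!]=0$, and $[\![c]\!]\neq0$ for some $c$. $DW(X)$ is the set of finitely supported probability distributions $\sum_{i=1}^np_i\langle r_i,x_i\rangle$ on $R\times X$, with $r\cdot\sum_ip_i\langle r_i,x_i\rangle=\sum_ip_i\langle r+r_i,x_i\rangle$; $p\mu+(1-p)\nu$ is the usual convex combination of distributions. The expected reward is $\mathbf E(\sum_ip_i\langle r_i,x_i\rangle)=\sum_ip_ir_i\in R$. **Strategies and $\mathrm{Op}_s$.** Strategies: a value has the single strategy $*$; those of $E_1\,\mathtt{or}\,E_2$ are $1s$ ($s\in\mathrm{Str}(E_1)$) and $2s$ ($s\in\mathrm{Str}(E_2)$); those of $c\cdot E$ are those of $E$; those of $E_1+_pE_2$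 are pairs $(s_1,s_2)$ with $s_i\in\mathrm{Str}(E_i)$. Outcomes in $DW(\mathrm{Val}_\sigma)$ for $E:\sigma$: $\mathrm{Out}( *,V)=\langle0,V\rangle$; $\mathrm{Out}(is,E_1\,\mathtt{or}\,E_2)=\mathrm{Out}(s,E_i)$; $\mathrm{Out}(s,c\cdot E)=[\![c]\!]\cdot\mathrm{Out}(s,E)$; $\mathrm{Out}((s_1,s_2),E_1+_pE_2)=p\,\mathrm{Out}(s_1,E_1)+(1-p)\,\mathrm{Out}(s_2,E_2)$. $\mathrm{Rew}(s,E)=\mathbf E(\mathrm{Out}(s,E))$. Strategies are totally ordered: on $E_1\,\mathtt{or}\,E_2$ all $1s$ precede all $2s'$, each group ordered as in $E_1$, resp. $E_2$; on $c\cdot E$ as in $E$; on $E_1+_pE_2$ lexicographically. For an effect value $E:\sigma$, $\mathrm{Op}_s(E)=\mathrm{Out}(s_{\rm opt},E)\in DW(\mathrm{Val}_\sigma)$, where $s_{\rm opt}$ is the least strategy of $E$ among those maximizing $\mathrm{Rew}(s,E)$. For $\gamma:X\to R$: $x\,\max_\gamma\,y=x$ if $\gamma(x)\ge\gamma(y)$, and $=y$ otherwise. *)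

theory Defs
  imports "HOL-Probability.Probability_Mass_Function"
begin

section \<open>The language\<close>

datatype 'b ty = Base 'b | UnitT | Prod "'b ty" "'b ty" | Arrow "'b ty" "'b ty"

text \<open>
  Base types, constants and function symbols are the elements of \<open>'b\<close>, \<open>'c\<close> and \<open>'f\<close>. Since
  types in HOL are not empty, \<open>fun_ty\<close> is partial, so that a language may have no function symbols:
  \<open>fun_ty S f = Some (bs, b)\<close> means \<open>f : bs \<rightarrow> b\<close>, and \<open>None\<close> that \<open>f\<close> is not a symbol of \<open>S\<close>.
\<close>

record ('b, 'c, 'f) signature =
  Bool_ty :: 'b
  Rew_ty :: 'b
  const_ty :: "'c \<Rightarrow> 'b"
  fun_ty :: "'f \<Rightarrow> ('b list \<times> 'b) option"
  tt_const :: 'c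
  ff_const :: 'c
  zero_const :: 'c

definition wf_signature :: "('b, 'c, 'f) signature \<Rightarrow> bool" where
  "wf_signature S \<longleftrightarrow>
     Bool_ty S \<noteq> Rew_ty S \<and> tt_const S \<noteq> ff_const S \<and>
     const_ty S (tt_const S) = Bool_ty S \<and> const_ty S (ff_const S) = Bool_ty S \<and>
     const_ty S (zero_const S) = Rew_ty S"

text \<open>
  Variables are de Bruijn indices, so terms are identified up to renaming of bound variables.
  \<open>Act N M\<close> is \<open>N \<cdot> M\<close> and \<open>PChoice p M N\<close> is \<open>M +\<^sub>p N\<close>.
\<close>

datatype ('b, 'c, 'f) tm =
    Var nat
  | Const 'c
  | FApp 'f "('b, 'c, 'f) tm list"
  | Ite "('b, 'c, 'f) tm" "('b, 'c, 'f) tm" "('b, 'c, 'f) tm"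
  | Or "('b, 'c, 'f) tm" "('b, 'c, 'f) tm"
  | Act "('b, 'c, 'f) tm" "('b, 'c, 'f) tm"
  | PChoice real "('b, 'c, 'f) tm" "('b, 'c, 'f) tm"
  | Star
  | Tuple "('b, 'c, 'f) tm" "('b, 'c, 'f) tm"
  | Fst "('b, 'c, 'f) tm"
  | Snd "('b, 'c, 'f) tm"
  | Lam "'b ty" "('b, 'c, 'f) tm"
  | App "('b, 'c, 'f) tm" "('b, 'c, 'f) tm"

inductive has_type ::
  "('b, 'c, 'f) signature \<Rightarrow> 'b ty list \<Rightarrow> ('b, 'c, 'f) tm \<Rightarrow> 'b ty \<Rightarrow> bool"
  for S :: "('b, 'c, 'f) signature" where
  "i < length \<Gamma> \<Longrightarrow> has_type S \<Gamma> (Var i) (\<Gamma> ! i)"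
| "has_type S \<Gamma> (Const c) (Base (const_ty S c))"
| "fun_ty S f = Some (bs, b) \<Longrightarrow> list_all2 (\<lambda>M b'. has_type S \<Gamma> M (Base b')) Ms bs \<Longrightarrow>
     has_type S \<Gamma> (FApp f Ms) (Base b)"
| "has_type S \<Gamma> L (Base (Bool_ty S)) \<Longrightarrow> has_type S \<Gamma> M \<sigma> \<Longrightarrow> has_type S \<Gamma> N \<sigma> \<Longrightarrow>
     has_type S \<Gamma> (Ite L M N) \<sigma>"
| "has_type S \<Gamma> M \<sigma> \<Longrightarrow> has_type S \<Gamma> N \<sigma> \<Longrightarrow> has_type S \<Gamma> (Or M N) \<sigma>"
| "has_type S \<Gamma> N (Base (Rew_ty S)) \<Longrightarrow> has_type S \<Gamma> M \<sigma> \<Longrightarrow> has_type S \<Gamma> (Act N M) \<sigma>"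
| "0 \<le> p \<Longrightarrow> p \<le> 1 \<Longrightarrow> has_type S \<Gamma> M \<sigma> \<Longrightarrow> has_type S \<Gamma> N \<sigma> \<Longrightarrow>
     has_type S \<Gamma> (PChoice p M N) \<sigma>"
| "has_type S \<Gamma> Star UnitT"
| "has_type S \<Gamma> M \<sigma> \<Longrightarrow> has_type S \<Gamma> N \<tau> \<Longrightarrow> has_type S \<Gamma> (Tuple M N) (Prod \<sigma> \<tau>)"
| "has_type S \<Gamma> M (Prod \<sigma> \<tau>) \<Longrightarrow> has_type S \<Gamma> (Fst M) \<sigma>"
| "has_type S \<Gamma> M (Prod \<sigma> \<tau>) \<Longrightarrow> has_type S \<Gamma> (Snd M) \<tau>"
| "has_type S (\<sigma> # \<Gamma>) M \<tau> \<Longrightarrow> has_type S \<Gamma> (Lam \<sigma> M) (Arrow \<sigma> \<tau>)"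
| "has_type S \<Gamma> M (Arrow \<sigma> \<tau>) \<Longrightarrow> has_type S \<Gamma> N \<sigma> \<Longrightarrow> has_type S \<Gamma> (App M N) \<tau>"

inductive is_value :: "('b, 'c, 'f) tm \<Rightarrow> bool" where
  "is_value (Const c)"
| "is_value Star"
| "is_value V \<Longrightarrow> is_value W \<Longrightarrow> is_value (Tuple V W)"
| "is_value (Lam \<sigma> M)"

inductive is_effval :: "('b, 'c, 'f) signature \<Rightarrow> ('b, 'c, 'f) tm \<Rightarrow> bool"
  for S :: "('b, 'c, 'f) signature" where
  "is_value V \<Longrightarrow> is_effval S V"
| "is_effval S E1 \<Longrightarrow> is_effval S E2 \<Longrightarrow> is_effval S (Or E1 E2)"
| "const_ty S c = Rew_ty S \<Longrightarrow> is_effval S E \<Longrightarrow> is_effval S (Act (Const c) E)"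
| "is_effval S E1 \<Longrightarrow> is_effval S E2 \<Longrightarrow> is_effval S (PChoice p E1 E2)"

definition Val :: "('b, 'c, 'f) signature \<Rightarrow> 'b ty \<Rightarrow> ('b, 'c, 'f) tm set" where
  "Val S \<sigma> = {V. is_value V \<and> has_type S [] V \<sigma>}"

definition EffVal :: "('b, 'c, 'f) signature \<Rightarrow> 'b ty \<Rightarrow> ('b, 'c, 'f) tm set" where
  "EffVal S \<sigma> = {E. is_effval S E \<and> has_type S [] E \<sigma>}"


section \<open>Rewards\<close>

text \<open>\<open>bary p x y\<close> is \<open>x +\<^sub>p y\<close>; only the values at \<open>p \<in> [0,1]\<close> matter.\<close>

locale barycentric_algebra =
  fixes bary :: "real \<Rightarrow> 'a \<Rightarrow> 'a \<Rightarrow> 'a"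
  assumes bary_one: "bary 1 x y = x"
    and bary_idem: "0 \<le> p \<Longrightarrow> p \<le> 1 \<Longrightarrow> bary p x x = x"
    and bary_commute: "0 \<le> p \<Longrightarrow> p \<le> 1 \<Longrightarrow> bary p x y = bary (1 - p) y x"
    and bary_assoc: "0 \<le> p \<Longrightarrow> p < 1 \<Longrightarrow> 0 \<le> q \<Longrightarrow> q < 1 \<Longrightarrow>
      bary q (bary p x y) z = bary (p * q) x (bary ((1 - p) * q / (1 - p * q)) y z)"

text \<open>
  \<open>convex_comb bary [(p\<^sub>1, x\<^sub>1), \<dots>, (p\<^sub>n, x\<^sub>n)]\<close> is \<open>\<Sum> p\<^sub>i x\<^sub>i\<close>, for \<open>n \<ge> 1\<close>, \<open>p\<^sub>i \<ge> 0\<close> and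
  \<open>\<Sum> p\<^sub>i = 1\<close>. If \<open>p\<^sub>1 = 1\<close>, the divisions by zero are harmless, as \<open>x +\<^sub>1 y = x\<close>.
\<close>

function convex_comb :: "(real \<Rightarrow> 'a \<Rightarrow> 'a \<Rightarrow> 'a) \<Rightarrow> (real \<times> 'a) list \<Rightarrow> 'a" where
  "convex_comb bary [] = undefined"
| "convex_comb bary [(p, x)] = x"
| "convex_comb bary ((p, x) # qy # qys) =
     bary p x (convex_comb bary (map (\<lambda>(q, y). (q / (1 - p), y)) (qy # qys)))"
  by pat_completeness auto
termination by (relation "Wellfounded.measure (length \<circ> snd)") auto

locale reward_structure = barycentric_algebra bary
  for bary :: "real \<Rightarrow> 'r::{linorder, comm_monoid_add} \<Rightarrow> 'r \<Rightarrow> 'r" +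
  assumes add_bary: "0 \<le> p \<Longrightarrow> p \<le> 1 \<Longrightarrow> r + bary p s s' = bary p (r + s) (r + s')"
    and le_iff_add_le: "r \<le> s \<longleftrightarrow> r + t \<le> s + t"
    and le_iff_bary_le: "0 < p \<Longrightarrow> p < 1 \<Longrightarrow> r \<le> s \<longleftrightarrow> bary p r t \<le> bary p s t"

definition wf_denotation ::
  "('b, 'c, 'f) signature \<Rightarrow> ('c \<Rightarrow> 'r::{linorder, comm_monoid_add}) \<Rightarrow> bool" where
  "wf_denotation S den \<longleftrightarrow>
     den (zero_const S) = 0 \<and> (\<exists>c. const_ty S c = Rew_ty S \<and> den c \<noteq> 0)"


section \<open>Distributions of rewards and results\<close>

definition DW :: "'x set \<Rightarrow> ('r \<times> 'x) pmf set" where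
  "DW X = {\<mu>. finite (set_pmf \<mu>) \<and> set_pmf \<mu> \<subseteq> UNIV \<times> X}"

definition act :: "'r::comm_monoid_add \<Rightarrow> ('r \<times> 'x) pmf \<Rightarrow> ('r \<times> 'x) pmf" where
  "act r \<mu> = map_pmf (\<lambda>(s, x). (r + s, x)) \<mu>"

definition mix :: "real \<Rightarrow> 'x pmf \<Rightarrow> 'x pmf \<Rightarrow> 'x pmf" where
  "mix p \<mu> \<nu> = bind_pmf (bernoulli_pmf p) (\<lambda>b. if b then \<mu> else \<nu>)"

lemma pmf_mix:
  assumes "0 \<le> p" "p \<le> 1"
  shows "pmf (mix p \<mu> \<nu>) x = p * pmf \<mu> x + (1 - p) * pmf \<nu> x"
  using assms by (simp add: mix_def pmf_bind mult.commute)

text \<open>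
  The convex combination does not depend on the order of its summands, so any enumeration of the
  (finite) support may be chosen.
\<close>

definition expected_reward :: "(real \<Rightarrow> 'r \<Rightarrow> 'r \<Rightarrow> 'r) \<Rightarrow> ('r \<times> 'x) pmf \<Rightarrow> 'r" where
  "expected_reward bary \<mu> =
     convex_comb bary
       (map (\<lambda>(r, x). (pmf \<mu> (r, x), r)) (SOME xs. distinct xs \<and> set xs = set_pmf \<mu>))"

definition max_by :: "('x \<Rightarrow> 'r::linorder) \<Rightarrow> 'x \<Rightarrow> 'x \<Rightarrow> 'x" where
  "max_by \<gamma> x y = (if \<gamma> x \<ge> \<gamma> y then x else y)"


section \<open>Strategies\<close>

datatype strategy = SVal | SLeft strategy | SRight strategy | SPair strategy strategy

text \<open>
  In \<open>Str\<close> and \<open>Out\<close> the last equation is meant for values; what they return on terms that are not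
  effect values, or on strategies that are not strategies of the given term, is irrelevant.
\<close>

fun Str :: "('b, 'c, 'f) tm \<Rightarrow> strategy set" where
  "Str (Or E1 E2) = SLeft ` Str E1 \<union> SRight ` Str E2"
| "Str (Act (Const c) E) = Str E"
| "Str (PChoice p E1 E2) = {SPair s1 s2 | s1 s2. s1 \<in> Str E1 \<and> s2 \<in> Str E2}"
| "Str V = {SVal}"

fun Out :: "('c \<Rightarrow> 'r::comm_monoid_add) \<Rightarrow> ('b, 'c, 'f) tm \<Rightarrow> strategy \<Rightarrow>
    ('r \<times> ('b, 'c, 'f) tm) pmf" where
  "Out den (Or E1 E2) (SLeft s) = Out den E1 s"
| "Out den (Or E1 E2) (SRight s) = Out den E2 s"
| "Out den (Act (Const c) E) s = act (den c) (Out den E s)"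
| "Out den (PChoice p E1 E2) (SPair s1 s2) = mix p (Out den E1 s1) (Out den E2 s2)"
| "Out den V s = return_pmf (0, V)"

definition Rew :: "(real \<Rightarrow> 'r \<Rightarrow> 'r \<Rightarrow> 'r) \<Rightarrow> ('c \<Rightarrow> 'r::comm_monoid_add) \<Rightarrow>
    ('b, 'c, 'f) tm \<Rightarrow> strategy \<Rightarrow> 'r" where
  "Rew bary den E s = expected_reward bary (Out den E s)"

text \<open>
  The order on the strategies of \<open>E\<close> can be read off from the strategies alone, since strategies of
  the same effect value have the same shape up to \<open>SLeft\<close> and \<open>SRight\<close>.
\<close>

fun strategy_less :: "strategy \<Rightarrow> strategy \<Rightarrow> bool" where
  "strategy_less (SLeft s) (SLeft t) = strategy_less s t"
| "strategy_less (SLeft s) (SRight t) = True"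
| "strategy_less (SRight s) (SRight t) = strategy_less s t"
| "strategy_less (SPair s1 s2) (SPair t1 t2) =
     (strategy_less s1 t1 \<or> s1 = t1 \<and> strategy_less s2 t2)"
| "strategy_less _ _ = False"

definition max_strategies :: "(real \<Rightarrow> 'r \<Rightarrow> 'r \<Rightarrow> 'r) \<Rightarrow>
    ('c \<Rightarrow> 'r::{linorder, comm_monoid_add}) \<Rightarrow> ('b, 'c, 'f) tm \<Rightarrow> strategy set" where
  "max_strategies bary den E =
     {s \<in> Str E. \<forall>t \<in> Str E. Rew bary den E t \<le> Rew bary den E s}"

definition opt_strategy :: "(real \<Rightarrow> 'r \<Rightarrow> 'r \<Rightarrow> 'r) \<Rightarrow>
    ('c \<Rightarrow> 'r::{linorder, comm_monoid_add}) \<Rightarrow> ('b, 'c, 'f) tm \<Rightarrow> strategy" where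
  "opt_strategy bary den E =
     (THE s. s \<in> max_strategies bary den E \<and>
        (\<forall>t \<in> max_strategies bary den E. t \<noteq> s \<longrightarrow> strategy_less s t))"

definition Op :: "(real \<Rightarrow> 'r \<Rightarrow> 'r \<Rightarrow> 'r) \<Rightarrow>
    ('c \<Rightarrow> 'r::{linorder, comm_monoid_add}) \<Rightarrow> ('b, 'c, 'f) tm \<Rightarrow>
    ('r \<times> ('b, 'c, 'f) tm) pmf" where
  "Op bary den E = Out den E (opt_strategy bary den E)"


section \<open>The optimal strategy exists\<close>

lemma finite_Str: "finite (Str E)"
proof (induction E rule: Str.induct)
  case (3 p E1 E2)
  have "Str (PChoice p E1 E2) = (\<lambda>(s1, s2). SPair s1 s2) ` (Str E1 \<times> Str E2)" by auto
  with 3 show ?case by simp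
qed auto

lemma Str_nonempty: "Str E \<noteq> {}"
  by (induction E rule: Str.induct) auto

lemma strategy_less_irrefl: "\<not> strategy_less s s"
  by (induction s) auto

lemma strategy_less_trans: "strategy_less s t \<Longrightarrow> strategy_less t u \<Longrightarrow> strategy_less s u"
proof (induction s t arbitrary: u rule: strategy_less.induct)
  case (1 s t) then show ?case by (cases u) auto
next
  case (2 s t) then show ?case by (cases u) auto
next
  case (3 s t) then show ?case by (cases u) auto
next
  case (4 s1 s2 t1 t2) then show ?case by (cases u) auto
qed auto

lemma strategy_less_total:
  "s \<in> Str E \<Longrightarrow> t \<in> Str E \<Longrightarrow> s \<noteq> t \<Longrightarrow> strategy_less s t \<or> strategy_less t s"
proof (induction E arbitrary: s t rule: Str.induct)
  case (3 p E1 E2)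
  then obtain s1 s2 t1 t2 where "s = SPair s1 s2" "t = SPair t1 t2"
    "s1 \<in> Str E1" "s2 \<in> Str E2" "t1 \<in> Str E1" "t2 \<in> Str E2" by auto
  with 3 show ?case by (cases "s1 = t1") auto
next
  case (1 E1 E2) then show ?case by (auto; blast)
qed auto

lemma ex1_opt_strategy:
  "\<exists>!s. s \<in> max_strategies bary den E \<and>
     (\<forall>t \<in> max_strategies bary den E. t \<noteq> s \<longrightarrow> strategy_less s t)"
proof -
  let ?A = "max_strategies bary den E"
  have A: "finite ?A" "?A \<subseteq> Str E"
    using finite_Str[of E] by (auto simp: max_strategies_def)
  let ?m = "Max ((\<lambda>t. Rew bary den E t) ` Str E)"
  have "?m \<in> (\<lambda>t. Rew bary den E t) ` Str E"
    using finite_Str[of E] Str_nonempty[of E] by (intro Max_in) auto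
  then obtain s where s: "s \<in> Str E" "Rew bary den E s = ?m" by auto
  then have "s \<in> ?A"
    using finite_Str[of E] by (auto simp: max_strategies_def)
  then have ne: "?A \<noteq> {}" by auto
  have least: "B \<subseteq> Str E \<Longrightarrow> B \<noteq> {} \<Longrightarrow> \<exists>s\<in>B. \<forall>t\<in>B. t \<noteq> s \<longrightarrow> strategy_less s t"
    if "finite B" for B
    using that
  proof (induction B rule: finite_induct)
    case (insert x B)
    show ?case
    proof (cases "B = {}")
      case False
      with insert obtain s where s: "s \<in> B" "\<forall>t\<in>B. t \<noteq> s \<longrightarrow> strategy_less s t" by auto
      have "x \<noteq> s" using s insert by auto
      then consider "strategy_less s x" | "strategy_less x s"
        using strategy_less_total[of s E x] s insert by auto
      then show ?thesis
      proof cases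
        case 1 with s show ?thesis by auto
      next
        case 2 with s show ?thesis by (metis insert_iff strategy_less_trans)
      qed
    qed auto
  qed simp
  from least[OF A ne] obtain s where s: "s \<in> ?A" "\<forall>t\<in>?A. t \<noteq> s \<longrightarrow> strategy_less s t"
    by blast
  show ?thesis
  proof (rule ex1I[of _ s])
    fix t assume t: "t \<in> ?A \<and> (\<forall>u\<in>?A. u \<noteq> t \<longrightarrow> strategy_less t u)"
    show "t = s"
    proof (rule ccontr)
      assume "t \<noteq> s"
      with s t have "strategy_less s t" "strategy_less t s" by auto
      then show False using strategy_less_trans strategy_less_irrefl by blast
    qed
  qed (use s in auto)
qed

lemma Out_in_DW: "E \<in> EffVal S \<sigma> \<Longrightarrow> s \<in> Str E \<Longrightarrow> Out den E s \<in> DW (Val S \<sigma>)"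
proof -
  assume E: "E \<in> EffVal S \<sigma>" and s: "s \<in> Str E"
  from E have "is_effval S E" "has_type S [] E \<sigma>" by (auto simp: EffVal_def)
  then show ?thesis using s
  proof (induction arbitrary: s rule: is_effval.induct)
    case (1 V)
    from 1(1) have "Out den V s = return_pmf (0, V)" by cases auto
    with 1 show ?case by (simp add: DW_def Val_def)
  next
    case (2 E1 E2)
    from 2(5) have "has_type S [] E1 \<sigma>" "has_type S [] E2 \<sigma>" by (auto elim: has_type.cases)
    with 2 show ?case by auto
  next
    case (3 c E)
    from 3(4) have "has_type S [] E \<sigma>" by (auto elim: has_type.cases)
    with 3 have "Out den E s \<in> DW (Val S \<sigma>)" by auto
    then show ?case by (auto simp: DW_def act_def)
  next
    case (4 E1 E2 p)
    from 4(5) have "has_type S [] E1 \<sigma>" "has_type S [] E2 \<sigma>" by (auto elim: has_type.cases)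
    with 4 obtain s1 s2 where s: "s = SPair s1 s2"
      and D: "Out den E1 s1 \<in> DW (Val S \<sigma>)" "Out den E2 s2 \<in> DW (Val S \<sigma>)" by auto
    have "set_pmf (mix p (Out den E1 s1) (Out den E2 s2))
            \<subseteq> set_pmf (Out den E1 s1) \<union> set_pmf (Out den E2 s2)"
      by (auto simp: mix_def split: if_splits)
    with D show ?case unfolding s DW_def
      by (auto intro: finite_subset)
  qed
qed

lemma Op_in_DW: "E \<in> EffVal S \<sigma> \<Longrightarrow> Op bary den E \<in> DW (Val S \<sigma>)"
  unfolding Op_def
  using theI'[OF ex1_opt_strategy[of bary den E]]
  by (intro Out_in_DW) (auto simp: opt_strategy_def max_strategies_def)

end

theory Submission
  imports Defs
begin

text \<open>
  The expected reward is affine, so the reward of \<open>(s\<^sub>1, s\<^sub>2)\<close> on \<open>E\<^sub>1 +\<^sub>p E\<^sub>2\<close> is the convex combination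
  of those of \<open>s\<^sub>1\<close> and \<open>s\<^sub>2\<close>. For \<open>0 < p < 1\<close> it is strictly monotone in both, so the maximizing pairs
  are the pairs of maximizing strategies, and the least one is the pair of the optimal ones. For
  \<open>p \<in> {0, 1}\<close> one component of the optimal pair need not be optimal, but it does not affect the outcome.

  Affinity needs that convex combinations in a barycentric algebra may be reordered and that equal
  elements may be merged. This comes for free once the algebra is embedded as the base of a cone,
  which is a commutative monoid: add \<open>t x\<close> and \<open>u y\<close> to \<open>(t + u) (x +\<^sub>q y)\<close> with \<open>q = t / (t + u)\<close>.
\<close>

section \<open>The cone over a barycentric algebra\<close>

text \<open>
  \<open>None\<close> is the apex and \<open>Some (a, x)\<close> stands for \<open>exp a\<close> times \<open>x\<close>: with logarithmic weights every
  element of the type represents a point, so the monoid laws hold without side conditions.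
\<close>

fun cone_add :: "(real \<Rightarrow> 'a \<Rightarrow> 'a \<Rightarrow> 'a) \<Rightarrow> (real \<times> 'a) option \<Rightarrow> (real \<times> 'a) option \<Rightarrow>
    (real \<times> 'a) option" where
  "cone_add bary None v = v"
| "cone_add bary u None = u"
| "cone_add bary (Some (a, x)) (Some (b, y)) =
     Some (ln (exp a + exp b), bary (exp a / (exp a + exp b)) x y)"

text \<open>The point of weight \<open>w\<close> over \<open>x\<close>, with \<open>w\<close> on the
  ordinary scale. Weight 0 gives the apex; negative weights do so only as a default.\<close>

definition ray :: "real \<Rightarrow> 'a \<Rightarrow> (real \<times> 'a) option" where
  "ray w x = (if w > 0 then Some (ln w, x) else None)"

text \<open>Multiplication by \<open>c\<close> for \<open>c > 0\<close>, which on logarithmic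
  weights is a shift by \<open>ln c\<close>.\<close>

definition cone_scale :: "real \<Rightarrow> (real \<times> 'a) option \<Rightarrow> (real \<times> 'a) option" where
  "cone_scale c = map_option (\<lambda>(a, x). (a + ln c, x))"

definition cone_translate :: "'a::plus \<Rightarrow> (real \<times> 'a) option \<Rightarrow> (real \<times> 'a) option" where
  "cone_translate r = map_option (\<lambda>(a, x). (a, r + x))"

lemma cone_scale_ray: "c > 0 \<Longrightarrow> cone_scale c (ray w x) = ray (c * w) x"
  by (simp add: cone_scale_def ray_def ln_mult zero_less_mult_iff)

lemma cone_scale_None [simp]: "cone_scale c None = None"
  by (simp add: cone_scale_def)

lemma ray_zero [simp]: "ray 0 x = None"
  by (simp add: ray_def)

lemma cone_scale_add:
  assumes "c > 0"
  shows "cone_scale c (cone_add bary u v) = cone_add bary (cone_scale c u) (cone_scale c v)"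
proof (cases u; cases v)
  fix ax bx assume "u = Some ax" "v = Some bx"
  moreover obtain a x b y where "ax = (a, x)" "bx = (b, y)" by fastforce
  \<comment> \<open>The common factor \<open>c\<close> cancels in the parameter of
    \<open>bary\<close> and splits off under the logarithm.\<close>
  moreover have "exp a * c + exp b * c = (exp a + exp b) * c" by (simp add: algebra_simps)
  moreover have "exp a + exp b > 0" by (simp add: add_pos_pos)
  ultimately show ?thesis
    using assms by (simp add: cone_scale_def exp_add ln_mult)
qed (simp_all add: cone_scale_def)

lemma cone_add_ray:
  assumes "t > 0" "u > 0"
  shows "cone_add bary (ray t x) (ray u y) = ray (t + u) (bary (t / (t + u)) x y)"
  using assms by (simp add: ray_def)

section \<open>The cone as a commutative monoid\<close>

context barycentric_algebra
begin

lemma bary_zero: "bary 0 x y = y"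
  using bary_commute[of 0 x y] bary_one by simp

lemma cone_add_commute: "cone_add bary u v = cone_add bary v u"
proof (cases u; cases v)
  fix ax bx assume "u = Some ax" "v = Some bx"
  moreover obtain a x b y where "ax = (a, x)" "bx = (b, y)" by fastforce
  moreover have "bary (exp a / (exp a + exp b)) x y = bary (exp b / (exp a + exp b)) y x"
  proof -
    have pos: "exp a + exp b > 0" by (simp add: add_pos_pos)
    then have "1 - exp a / (exp a + exp b) = exp b / (exp a + exp b)" by (simp add: field_simps)
    moreover have "0 \<le> exp a / (exp a + exp b)" "exp a / (exp a + exp b) \<le> 1"
      using pos by (simp_all add: field_simps)
    ultimately show ?thesis using bary_commute by metis
  qed
  ultimately show ?thesis by (simp add: add.commute)
qed simp_all

text \<open>This is \<open>bary_assoc\<close> in homogeneous weights, for p = A / (A + B) and q = (A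
  + B) / (A + B + C). Positive weights keep both parameters below 1.\<close>

lemma bary_weights_assoc:
  assumes "A > 0" "B > 0" "C > 0"
  shows "bary ((A + B) / (A + B + C)) (bary (A / (A + B)) x y) z =
    bary (A / (A + B + C)) x (bary (B / (B + C)) y z)"
proof -
  let ?p = "A / (A + B)" and ?q = "(A + B) / (A + B + C)"
  have ab: "A + B \<noteq> 0" "A + B + C \<noteq> 0" "B + C \<noteq> 0" using assms by auto
  have pq: "?p * ?q = A / (A + B + C)" using ab by simp
  have "1 - ?p = B / (A + B)" using ab by (simp add: field_simps)
  then have "(1 - ?p) * ?q = B / (A + B + C)" using ab by simp
  moreover have "1 - ?p * ?q = (B + C) / (A + B + C)" unfolding pq using ab by (simp add: field_simps)
  ultimately have "(1 - ?p) * ?q / (1 - ?p * ?q) = B / (B + C)" using ab by simp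
  moreover have "bary ?q (bary ?p x y) z =
      bary (?p * ?q) x (bary ((1 - ?p) * ?q / (1 - ?p * ?q)) y z)"
    using assms by (intro bary_assoc) (auto simp: field_simps)
  ultimately show ?thesis unfolding pq by simp
qed

lemma cone_add_assoc:
  "cone_add bary (cone_add bary u v) w = cone_add bary u (cone_add bary v w)"
proof (cases "u = None \<or> v = None \<or> w = None")
  case True
  then show ?thesis by (auto simp: cone_add_commute[of _ None])
next
  case False
  then obtain a x b y c z where "u = Some (a, x)" "v = Some (b, y)" "w = Some (c, z)" by auto
  then show ?thesis
    using bary_weights_assoc[of "exp a" "exp b" "exp c"] by (simp add: add_pos_pos add.assoc)
qed

text \<open>This provides sums \<open>cone.F\<close> over finite sets, which are independent of any
  enumeration.\<close>

sublocale cone: comm_monoid_set "cone_add bary" None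
proof
  show "cone_add bary u None = u" for u by (cases u) auto
qed (rule cone_add_assoc cone_add_commute)+

text \<open>For positive weights this is idempotence of \<open>bary\<close>; it is what merges equal
  elements.\<close>

lemma ray_add:
  assumes "t \<ge> 0" "u \<ge> 0"
  shows "ray (t + u) x = cone_add bary (ray t x) (ray u x)"
proof (cases "t = 0 \<or> u = 0")
  case False
  with assms have "t > 0" "u > 0" by auto
  then show ?thesis by (simp add: cone_add_ray bary_idem)
qed auto

section \<open>Convex combinations as sums of rays\<close>

lemma cone_scale_sum:
  assumes "c > 0"
  shows "cone_scale c (cone.F f A) = cone.F (\<lambda>x. cone_scale c (f x)) A"
  by (induction A rule: infinite_finite_induct) (simp_all add: cone_scale_add assms)

text \<open>Each recursive call of \<open>convex_comb\<close> divides the remaining weights by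
  \<open>1 - p\<close>, and scaling the cone by \<open>1 - p\<close> undoes this. Since all weights
  are positive, \<open>1 - p > 0\<close> as long as the tail is not empty.\<close>

lemma ray_convex_comb:
  assumes "distinct zs" "\<And>z. z \<in> set zs \<Longrightarrow> w z > 0" "(\<Sum>z\<in>set zs. w z) = 1"
  shows "cone.F (\<lambda>z. ray (w z) (f z)) (set zs) =
    ray 1 (convex_comb bary (map (\<lambda>z. (w z, f z)) zs))"
  using assms
proof (induction zs arbitrary: w)
  case (Cons z zs)
  show ?case
  proof (cases "zs = []")
    case False
    define p where "p = w z"
    have p: "p > 0" using Cons.prems by (simp add: p_def)
    have sum: "(\<Sum>z\<in>set zs. w z) = 1 - p" using Cons.prems by (simp add: p_def)
    have "(\<Sum>z\<in>set zs. w z) > 0" using Cons.prems False by (intro sum_pos) auto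
    then have p1: "1 - p > 0" using sum by simp
    define C where "C = convex_comb bary (map (\<lambda>z. (w z / (1 - p), f z)) zs)"
    have "cone.F (\<lambda>z. ray (w z / (1 - p)) (f z)) (set zs) = ray 1 C"
      unfolding C_def using Cons.prems p1 sum
      by (intro Cons.IH) (simp_all flip: sum_divide_distrib)
    then have "cone_scale (1 - p) (cone.F (\<lambda>z. ray (w z / (1 - p)) (f z)) (set zs)) = ray (1 - p) C"
      using p1 by (simp add: cone_scale_ray)
    then have "cone.F (\<lambda>z. ray (w z) (f z)) (set zs) = ray (1 - p) C"
      using p1 by (simp add: cone_scale_sum cone_scale_ray)
    then have "cone.F (\<lambda>z. ray (w z) (f z)) (set (z # zs)) = cone_add bary (ray p (f z)) (ray (1 - p) C)"
      using Cons.prems by (simp add: p_def)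
    also have "\<dots> = ray 1 (bary p (f z) C)"
      using p p1 by (simp add: cone_add_ray)
    also have "bary p (f z) C = convex_comb bary (map (\<lambda>z. (w z, f z)) (z # zs))"
      using False by (cases zs) (simp_all add: C_def p_def o_def)
    finally show ?thesis .
  qed (use Cons.prems in simp)
qed simp

text \<open>The sum no longer mentions the chosen enumeration. A set \<open>A\<close> larger than
  the support is allowed so that several distributions can be summed over one index set; the extra
  points have weight 0 and add only the apex.\<close>

lemma ray_expected_reward:
  assumes "finite A" "set_pmf \<mu> \<subseteq> A"
  shows "ray 1 (expected_reward bary \<mu>) = cone.F (\<lambda>z. ray (pmf \<mu> z) (fst z)) A"
proof -
  define zs where "zs = (SOME xs. distinct xs \<and> set xs = set_pmf \<mu>)"
  have "\<exists>xs. distinct xs \<and> set xs = set_pmf \<mu>"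
    using finite_distinct_list[of "set_pmf \<mu>"] finite_subset[OF assms(2,1)] by auto
  from someI_ex[OF this] have zs: "distinct zs" "set zs = set_pmf \<mu>"
    by (auto simp: zs_def)
  have "ray 1 (expected_reward bary \<mu>) = ray 1 (convex_comb bary (map (\<lambda>z. (pmf \<mu> z, fst z)) zs))"
    by (simp add: expected_reward_def zs_def case_prod_beta')
  also have "\<dots> = cone.F (\<lambda>z. ray (pmf \<mu> z) (fst z)) (set zs)"
    using zs finite_subset[OF assms(2,1)]
    by (subst ray_convex_comb) (auto simp: pmf_positive sum_pmf_eq_1)
  also have "\<dots> = cone.F (\<lambda>z. ray (pmf \<mu> z) (fst z)) A"
    using zs assms by (intro cone.mono_neutral_left) (auto simp: set_pmf_iff)
  finally show ?thesis .
qed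

lemma ray_one_inject: "ray 1 x = ray 1 y \<longleftrightarrow> x = y"
  by (simp add: ray_def)

lemma mix_one: "mix 1 \<mu> \<nu> = \<mu>" and mix_zero: "mix 0 \<mu> \<nu> = \<nu>"
  by (rule pmf_eqI, simp add: pmf_mix)+

lemma expected_reward_mix:
  assumes "0 \<le> p" "p \<le> 1" "finite (set_pmf \<mu>)" "finite (set_pmf \<nu>)"
  shows "expected_reward bary (mix p \<mu> \<nu>) = bary p (expected_reward bary \<mu>) (expected_reward bary \<nu>)"
proof -
  \<comment> \<open>The cone is scaled by \<open>p\<close> and \<open>1 - p\<close> below, so both
    must be positive; the two endpoints are projections.\<close>
  consider "p = 0" | "p = 1" | "0 < p" "p < 1" using assms by linarith
  then show ?thesis
  proof cases
    case 3
    let ?A = "set_pmf \<mu> \<union> set_pmf \<nu>"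
    have "set_pmf (mix p \<mu> \<nu>) \<subseteq> ?A" by (auto simp: mix_def split: if_splits)
    then have "ray 1 (expected_reward bary (mix p \<mu> \<nu>)) =
        cone.F (\<lambda>z. ray (p * pmf \<mu> z + (1 - p) * pmf \<nu> z) (fst z)) ?A"
      using assms by (subst ray_expected_reward[of ?A]) (simp_all add: pmf_mix)
    also have "\<dots> = cone_add bary (cone.F (\<lambda>z. ray (p * pmf \<mu> z) (fst z)) ?A)
        (cone.F (\<lambda>z. ray ((1 - p) * pmf \<nu> z) (fst z)) ?A)"
      using 3 by (simp add: ray_add cone.distrib)
    also have "\<dots> = cone_add bary (cone_scale p (cone.F (\<lambda>z. ray (pmf \<mu> z) (fst z)) ?A))
        (cone_scale (1 - p) (cone.F (\<lambda>z. ray (pmf \<nu> z) (fst z)) ?A))"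
      using 3 by (simp add: cone_scale_sum cone_scale_ray)
    also have "\<dots> = cone_add bary (cone_scale p (ray 1 (expected_reward bary \<mu>)))
        (cone_scale (1 - p) (ray 1 (expected_reward bary \<nu>)))"
      using assms by (simp add: ray_expected_reward[of ?A])
    also have "\<dots> = ray 1 (bary p (expected_reward bary \<mu>) (expected_reward bary \<nu>))"
      using 3 by (simp add: cone_scale_ray cone_add_ray)
    finally show ?thesis by (simp add: ray_one_inject)
  qed (simp_all add: mix_one mix_zero bary_one bary_zero)
qed

end

section \<open>Rewards of strategies\<close>

context reward_structure
begin

lemma add_le_left_iff: "(r :: 'r) + s \<le> r + s' \<longleftrightarrow> s \<le> s'"
  using le_iff_add_le[of s s' r] by (simp add: add.commute)

lemma add_left_cancel_iff: "(r :: 'r) + s = r + s' \<longleftrightarrow> s = s'"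
  by (simp add: order_eq_iff add_le_left_iff)

lemma cone_translate_add:
  "cone_translate r (cone_add bary u v) = cone_add bary (cone_translate r u) (cone_translate r v)"
proof (cases u; cases v)
  fix ax bx assume "u = Some ax" "v = Some bx"
  moreover obtain a x b y where "ax = (a, x)" "bx = (b, y)" by fastforce
  moreover have "exp a / (exp a + exp b) \<le> 1" by (simp add: field_simps add_pos_pos)
  ultimately show ?thesis by (simp add: cone_translate_def add_bary add_pos_pos)
qed (simp_all add: cone_translate_def)

lemma cone_translate_sum:
  "cone_translate r (cone.F f A) = cone.F (\<lambda>z. cone_translate r (f z)) A"
proof (induction A rule: infinite_finite_induct)
  case (insert x A)
  then show ?case by (simp add: cone_translate_add)
qed (simp_all add: cone_translate_def)

text \<open>Translation by \<open>r\<close> is a homomorphism of the cone, because + distributes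
  over \<open>bary\<close>. It is injective on rewards, by cancellation, so no two outcomes merge
  and every probability is preserved.\<close>

lemma expected_reward_act:
  assumes "finite (set_pmf \<mu>)"
  shows "expected_reward bary (act r \<mu>) = r + expected_reward bary \<mu>"
proof -
  let ?g = "\<lambda>(s, x). (r + s, x)"
  have inj: "inj ?g" by (auto simp: inj_def add_left_cancel_iff)
  have pmf: "pmf (act r \<mu>) (r + fst z, snd z) = pmf \<mu> z" for z
    using pmf_map_inj'[OF inj, of \<mu> z] by (simp add: act_def case_prod_beta')
  have ray: "cone_translate r (ray w x) = ray w (r + x)" for w x
    by (simp add: cone_translate_def ray_def)
  have "ray 1 (expected_reward bary (act r \<mu>)) =
      cone.F (\<lambda>z. ray (pmf (act r \<mu>) z) (fst z)) (?g ` set_pmf \<mu>)"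
    using assms by (intro ray_expected_reward) (auto simp: act_def)
  also have "\<dots> = cone.F (\<lambda>z. ray (pmf \<mu> z) (r + fst z)) (set_pmf \<mu>)"
    using inj by (subst cone.reindex) (auto simp: pmf o_def case_prod_beta' intro: inj_on_subset)
  also have "\<dots> = cone_translate r (ray 1 (expected_reward bary \<mu>))"
    using assms by (simp add: ray_expected_reward[of "set_pmf \<mu>"] cone_translate_sum ray)
  finally show ?thesis by (simp add: ray ray_one_inject)
qed

lemma bary_mono_left_iff: "0 < p \<Longrightarrow> p < 1 \<Longrightarrow> bary p r t \<le> bary p s t \<longleftrightarrow> r \<le> s"
  using le_iff_bary_le by simp

lemma bary_mono_right_iff: "0 < p \<Longrightarrow> p < 1 \<Longrightarrow> bary p t r \<le> bary p t s \<longleftrightarrow> r \<le> s"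
  using le_iff_bary_le[of "1 - p" r s t] by (simp add: bary_commute[of p t])

end

lemma finite_set_pmf_Out:
  assumes "E \<in> EffVal S \<sigma>" "s \<in> Str E"
  shows "finite (set_pmf (Out den E s))"
  using Out_in_DW[OF assms, of den] by (simp add: DW_def)

section \<open>Optimal strategies\<close>

lemma opt_strategy_in_max_strategies: "opt_strategy bary den E \<in> max_strategies bary den E"
  and opt_strategy_least: "t \<in> max_strategies bary den E \<Longrightarrow> t \<noteq> opt_strategy bary den E \<Longrightarrow>
    strategy_less (opt_strategy bary den E) t"
  using theI'[OF ex1_opt_strategy[of bary den E]] by (auto simp: opt_strategy_def)

lemma opt_strategy_in_Str: "opt_strategy bary den E \<in> Str E"
  and Rew_le_opt: "t \<in> Str E \<Longrightarrow> Rew bary den E t \<le> Rew bary den E (opt_strategy bary den E)"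
  using opt_strategy_in_max_strategies[of bary den E] by (auto simp: max_strategies_def)

lemma opt_strategy_less:
  assumes "t \<in> Str E" "t \<noteq> opt_strategy bary den E"
    and "Rew bary den E (opt_strategy bary den E) \<le> Rew bary den E t"
  shows "strategy_less (opt_strategy bary den E) t"
  using assms Rew_le_opt[of _ E bary den]
  by (intro opt_strategy_least) (auto simp: max_strategies_def intro: order_trans)

text \<open>If the two strategies differed, each would precede the other.\<close>

lemma opt_strategy_eqI:
  assumes "s \<in> Str E" "\<And>t. t \<in> Str E \<Longrightarrow> Rew bary den E t \<le> Rew bary den E s"
    and "\<And>t. t \<in> Str E \<Longrightarrow> Rew bary den E s \<le> Rew bary den E t \<Longrightarrow> t \<noteq> s \<Longrightarrow> strategy_less s t"
  shows "opt_strategy bary den E = s"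
proof (rule ccontr)
  assume ne: "opt_strategy bary den E \<noteq> s"
  have "strategy_less (opt_strategy bary den E) s"
    using ne by (intro opt_strategy_less assms opt_strategy_in_Str) auto
  moreover have "strategy_less s (opt_strategy bary den E)"
    using assms ne opt_strategy_in_Str Rew_le_opt by metis
  ultimately show False using strategy_less_trans strategy_less_irrefl by blast
qed

lemma expected_reward_Op:
  "expected_reward bary (Op bary den E) = Rew bary den E (opt_strategy bary den E)"
  by (simp add: Op_def Rew_def)

section \<open>Optimal outcomes of values and of each effect\<close>

lemma Op_value:
  assumes "is_value V"
  shows "Op bary den V = return_pmf (0, V)"
  using assms by cases (auto simp: Op_def)

text \<open>A tie goes to the left on both sides: every \<open>SLeft\<close> precedes every
  \<open>SRight\<close>, and \<open>max_by\<close> keeps its first argument.\<close>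

lemma Op_Or:
  "Op bary den (Or E1 E2) = max_by (expected_reward bary) (Op bary den E1) (Op bary den E2)"
proof -
  let ?s1 = "opt_strategy bary den E1" and ?s2 = "opt_strategy bary den E2"
  have Rew: "Rew bary den (Or E1 E2) (SLeft s) = Rew bary den E1 s"
    "Rew bary den (Or E1 E2) (SRight s) = Rew bary den E2 s" for s
    by (simp_all add: Rew_def)
  show ?thesis
  proof (cases "Rew bary den E2 ?s2 \<le> Rew bary den E1 ?s1")
    case True
    have "opt_strategy bary den (Or E1 E2) = SLeft ?s1"
      using True opt_strategy_in_Str
      by (intro opt_strategy_eqI)
        (auto simp: Rew intro: Rew_le_opt opt_strategy_less order_trans[OF Rew_le_opt])
    then show ?thesis using True by (simp add: max_by_def expected_reward_Op) (simp add: Op_def)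
  next
    case False
    then have lt: "Rew bary den E1 s < Rew bary den E2 ?s2" if "s \<in> Str E1" for s
      using Rew_le_opt[OF that, of bary den] by (simp add: order.strict_trans1)
    have "opt_strategy bary den (Or E1 E2) = SRight ?s2"
      using opt_strategy_in_Str[of bary den E2]
      by (intro opt_strategy_eqI)
        (auto simp: Rew intro: Rew_le_opt opt_strategy_less order.strict_implies_order[OF lt] dest: lt)
    then show ?thesis using False by (simp add: max_by_def expected_reward_Op) (simp add: Op_def)
  qed
qed

context reward_structure
begin

text \<open>Adding a constant preserves and reflects the order of rewards, so the same strategy is
  optimal.\<close>

lemma Op_Act:
  assumes E: "E \<in> EffVal S \<sigma>"
  shows "Op bary den (Act (Const c) E) = act (den c) (Op bary den E)"
proof -
  have Rew: "Rew bary den (Act (Const c) E) s = den c + Rew bary den E s" if "s \<in> Str E" for s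
    using finite_set_pmf_Out[OF E that, of den] by (simp add: Rew_def expected_reward_act)
  have "opt_strategy bary den (Act (Const c) E) = opt_strategy bary den E"
    using opt_strategy_in_Str
    by (intro opt_strategy_eqI)
      (auto simp: Rew add_le_left_iff intro: Rew_le_opt opt_strategy_less)
  then show ?thesis by (simp add: Op_def)
qed

lemma Op_PChoice:
  assumes p: "0 \<le> p" "p \<le> 1" and E: "E1 \<in> EffVal S \<sigma>" "E2 \<in> EffVal S \<sigma>"
  shows "Op bary den (PChoice p E1 E2) = mix p (Op bary den E1) (Op bary den E2)"
proof -
  let ?E = "PChoice p E1 E2" and ?s = "opt_strategy bary den (PChoice p E1 E2)"
  let ?s1 = "opt_strategy bary den E1" and ?s2 = "opt_strategy bary den E2"
  have Rew: "Rew bary den ?E (SPair s1 s2) = bary p (Rew bary den E1 s1) (Rew bary den E2 s2)"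
    if "s1 \<in> Str E1" "s2 \<in> Str E2" for s1 s2
    using finite_set_pmf_Out[OF E(1) that(1), of den] finite_set_pmf_Out[OF E(2) that(2), of den] p
    by (simp add: Rew_def expected_reward_mix)
  \<comment> \<open>Taking the optimal pair apart, rather than testing the pair of optimal
    strategies, covers \<open>p = 0\<close> and \<open>p = 1\<close> too, where only one component
    is determined.\<close>
  obtain t1 t2 where t: "?s = SPair t1 t2" "t1 \<in> Str E1" "t2 \<in> Str E2"
    using opt_strategy_in_Str[of bary den ?E] by auto
  have least: "strategy_less (SPair t1 t2) (SPair u1 u2)"
    if "u1 \<in> Str E1" "u2 \<in> Str E2" "SPair u1 u2 \<noteq> SPair t1 t2"
      "Rew bary den ?E (SPair t1 t2) \<le> Rew bary den ?E (SPair u1 u2)" for u1 u2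
    using opt_strategy_less[of "SPair u1 u2" ?E bary den] that t by auto
  have max: "Rew bary den ?E (SPair u1 u2) \<le> Rew bary den ?E (SPair t1 t2)"
    if "u1 \<in> Str E1" "u2 \<in> Str E2" for u1 u2
    using Rew_le_opt[of "SPair u1 u2" ?E bary den] that t by auto
  \<comment> \<open>Only the first component varies. With \<open>t2\<close> fixed, the lexicographic
    order compares first components, as \<open>strategy_less t2 t2\<close> is false.\<close>
  have 1: "?s1 = t1" if "0 < p"
  proof (rule opt_strategy_eqI[OF t(2)])
    have mono: "bary p a x \<le> bary p b x \<longleftrightarrow> a \<le> b" for a b x
      using that p bary_mono_left_iff by (cases "p = 1") (auto simp: bary_one)
    fix u assume u: "u \<in> Str E1"
    show "Rew bary den E1 u \<le> Rew bary den E1 t1"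
      using max[OF u t(3)] u t by (simp add: Rew mono)
    assume "Rew bary den E1 t1 \<le> Rew bary den E1 u" "u \<noteq> t1"
    then show "strategy_less t1 u"
      using least[OF u t(3)] u t by (simp add: Rew mono strategy_less_irrefl)
  qed
  have 2: "?s2 = t2" if "p < 1"
  proof (rule opt_strategy_eqI[OF t(3)])
    \<comment> \<open>For \<open>p = 0\<close> this holds because \<open>bary 0\<close> is the
      second projection.\<close>
    have mono: "bary p x a \<le> bary p x b \<longleftrightarrow> a \<le> b" for a b x
      using that p bary_mono_right_iff by (cases "p = 0") (auto simp: bary_zero)
    fix u assume u: "u \<in> Str E2"
    show "Rew bary den E2 u \<le> Rew bary den E2 t2"
      using max[OF t(2) u] u t by (simp add: Rew mono)
    assume "Rew bary den E2 t2 \<le> Rew bary den E2 u" "u \<noteq> t2"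
    then show "strategy_less t2 u"
      using least[OF t(2) u] u t by (simp add: Rew mono strategy_less_irrefl)
  qed
  consider "p = 0" | "p = 1" | "0 < p" "p < 1" using p by linarith
  then show ?thesis
    by cases (use t(1) 1 2 in \<open>auto simp: Op_def mix_one mix_zero\<close>)
qed

end

theorem theorem5p3:
  fixes S :: "('b, 'c, 'f) signature"
    and bary :: "real \<Rightarrow> 'r \<Rightarrow> 'r \<Rightarrow> 'r::{linorder, comm_monoid_add}"
    and den :: "'c \<Rightarrow> 'r"
  assumes "wf_signature S"
    and "reward_structure bary"
    and "wf_denotation S den"
  shows "(\<forall>\<sigma>. \<forall>V \<in> Val S \<sigma>. Op bary den V = return_pmf (0, V)) \<and>
    (\<forall>\<sigma>. \<forall>E1 \<in> EffVal S \<sigma>. \<forall>E2 \<in> EffVal S \<sigma>.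
       Op bary den (Or E1 E2) =
         max_by (expected_reward bary) (Op bary den E1) (Op bary den E2)) \<and>
    (\<forall>\<sigma> c. \<forall>E \<in> EffVal S \<sigma>. const_ty S c = Rew_ty S \<longrightarrow>
       Op bary den (Act (Const c) E) = act (den c) (Op bary den E)) \<and>
    (\<forall>\<sigma>. \<forall>p \<in> {0..1}. \<forall>E1 \<in> EffVal S \<sigma>. \<forall>E2 \<in> EffVal S \<sigma>.
       Op bary den (PChoice p E1 E2) = mix p (Op bary den E1) (Op bary den E2))"
proof -
  interpret reward_structure bary by fact
  show ?thesis
    using Op_value Op_Or Op_Act Op_PChoice by (auto simp: Val_def)
qed

end
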